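(* Under the standing assumptions below, let $c\in\mathcal{C}_{n-1}(n,q)$ with $\mathrm{wt}(c)\leq W(n,q)$ and suppose that $|\mathcal{P}_c^\infty|\leq|\mathbb{H}_c^\infty|-2$. Then $c$ is not minimal.
   Context: Standing assumptions: $p$ is a prime, $q=p^h$ with $h\geq 2$, $q>27$, $n\geq 2$, and $q\geq\max\{32,2^{2n-4}\}$ if $h>2$, while $q\geq 2^{2n}$ if $h=2$. $\mathrm{PG}(n,q)$ is the Desarguesian projective space over $\mathbb{F}_q$; $\theta_m:=\frac{q^{m+1}-1}{q-1}$. $\mathcal{C}_{n-1}(n,q)$ is the $\mathbb{F}_p$-span of the characteristic functions (values in $\mathbb{F}_p$) of the hyperplanes of $\mathrm{PG}(n,q)$, as functions on points; hyperplanes are identified with their characteristic functions. $\mathrm{supp}(c)=\{P:c(P)\neq0\}$, $\mathrm{wt}(c)=|\mathrm{supp}(c)|$, $m_c:=\lceil\mathrm{wt}(c)/\theta_{n-1}\rceil$. $\Delta_{n,q}:=\lfloor 2^{-(n-2)}\sqrt{q}\rfloor$ if $h>2$, $\Delta_{n,q}:=\lfloor p/2^n\rfloor$ if $h=2$; $W(n,q):=(\Delta_{n,q}-1)\theta_{n-1}$. For $c$ with $\mathrm{wt}(c)\leq W(n,q)$, $c$ is a linear combination with nonzero coefficients of a uniquely determined set $\mathcal{H}_c$ of exactly $m_c$ distinct hyperplanes, with uniquely determined coefficients; write $c(H)$ for the coefficient of $H\in\mathcal{H}_c$. For $\mathcal{H}\subseteq\mathcal{H}_c$ put $c|_{\mathcal{H}}:=\sum_{H\in\mathcal{H}}c(H)H$.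 Points not in $\mathrm{supp}(c)$ are holes of $c$. For a partition $\mathbb{H}$ of $\mathcal{H}_c$, let $\Gamma_{\mathbb{H}}$ be the graph with vertex set $\mathbb{H}$ in which distinct $\mathcal{H}_1,\mathcal{H}_2$ are adjacent iff there is a point $P$ such that: $P$ is a hole of $c$; $c|_{\mathcal{H}_1}(P)\neq0$ and $c|_{\mathcal{H}_2}(P)\neq0$; and $c|_{\mathcal{H}}(P)=0$ for all $\mathcal{H}\in\mathbb{H}\setminus\{\mathcal{H}_1,\mathcal{H}_2\}$. Let $\mathbb{H}_c^0$ be the partition of $\mathcal{H}_c$ into singletons, and $\mathbb{H}_c^{i+1}$ the partition whose parts are the unions of the parts in each connected component of $\Gamma_{\mathbb{H}_c^i}$. This sequence stabilizes; $\mathbb{H}_c^\infty$ is the eventual constant partition. $\mathcal{P}_c^\infty$ is the set of holes $P$ of $c$ for which there exists $\mathcal{H}\in\mathbb{H}_c^\infty$ with $c|_{\mathcal{H}}(P)\neq0$. A codeword $c$ is minimal if for every $c'\in\mathcal{C}_{n-1}(n,q)$ with $\mathrm{supp}(c')\subseteq\mathrm{supp}(c)$ there is $\alpha\in\mathbb{F}_p$ with $c'=\alpha c$. *)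

theory Defs
  imports "HOL-Analysis.Cartesian_Space" "HOL-Library.Function_Algebras"
    "HOL-Computational_Algebra.Primes"
begin

text \<open>
  PG(n,q) is modelled on the vector space \<^typ>\<open>'a ^ 'm\<close> over the finite field \<^typ>\<open>'a\<close>, where
  CARD('a) = q and CARD('m) = n + 1; dimensions below are vector space dimensions, one more than
  the projective ones. The prime field is a field \<^typ>\<open>'k\<close> with CARD('k) = p.
\<close>

definition pg_points :: "('a::field ^ 'm::finite) set set" where
  "pg_points = {P. vec.subspace P \<and> vec.dim P = 1}"

definition pg_hyperplanes :: "('a::field ^ 'm::finite) set set" where
  "pg_hyperplanes = {H. vec.subspace H \<and> vec.dim H + 1 = CARD('m)}"

definition theta :: "nat \<Rightarrow> nat \<Rightarrow> real" where
  "theta q m = (real q ^ (m + 1) - 1) / (real q - 1)"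

text \<open>
  Functions on points are represented by functions on all sets of vectors that vanish on every
  set that is not a point.
\<close>

definition char_fun :: "('a::field ^ 'm::finite) set \<Rightarrow> ('a ^ 'm) set \<Rightarrow> 'k::field" where
  "char_fun H P = (if P \<in> pg_points \<and> P \<subseteq> H then 1 else 0)"

definition fun_scale :: "'k::field \<Rightarrow> ('b \<Rightarrow> 'k) \<Rightarrow> 'b \<Rightarrow> 'k" where
  "fun_scale a f = (\<lambda>x. a * f x)"

global_interpretation funsp: vector_space "fun_scale :: 'k::field \<Rightarrow> ('b \<Rightarrow> 'k) \<Rightarrow> 'b \<Rightarrow> 'k"
  by unfold_locales (auto simp: fun_scale_def fun_eq_iff algebra_simps)

definition hyp_code :: "(('a::field ^ 'm::finite) set \<Rightarrow> 'k::field) set" where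
  "hyp_code = funsp.span (char_fun ` pg_hyperplanes)"

definition supp :: "(('a::field ^ 'm::finite) set \<Rightarrow> 'k::field) \<Rightarrow> ('a ^ 'm) set set" where
  "supp c = {P \<in> pg_points. c P \<noteq> 0}"

definition holes :: "(('a::field ^ 'm::finite) set \<Rightarrow> 'k::field) \<Rightarrow> ('a ^ 'm) set set" where
  "holes c = pg_points - supp c"

definition wt :: "(('a::field ^ 'm::finite) set \<Rightarrow> 'k::field) \<Rightarrow> nat" where
  "wt c = card (supp c)"

definition minimal_codeword :: "(('a::field ^ 'm::finite) set \<Rightarrow> 'k::field) \<Rightarrow> bool" where
  "minimal_codeword c \<longleftrightarrow>
     (\<forall>c' \<in> hyp_code. supp c' \<subseteq> supp c \<longrightarrow> (\<exists>\<alpha>. c' = fun_scale \<alpha> c))"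

definition Delta :: "nat \<Rightarrow> nat \<Rightarrow> nat \<Rightarrow> int" where
  "Delta p h n =
     (if h > 2 then \<lfloor>sqrt (real (p ^ h)) / 2 ^ (n - 2)\<rfloor> else \<lfloor>real p / 2 ^ n\<rfloor>)"

definition W :: "nat \<Rightarrow> nat \<Rightarrow> nat \<Rightarrow> real" where
  "W p h n = (of_int (Delta p h n) - 1) * theta (p ^ h) (n - 1)"

text \<open>Here CARD('m) - 2 = n - 1.\<close>

definition m_of :: "(('a::{field,finite} ^ 'm::finite) set \<Rightarrow> 'k::field) \<Rightarrow> nat" where
  "m_of c = nat \<lceil>real (wt c) / theta CARD('a) (CARD('m) - 2)\<rceil>"

text \<open>
  \<open>a\<close> writes \<open>c\<close> as a linear combination, with nonzero coefficients, of exactly \<open>m_of c\<close> distinct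
  hyperplanes; \<open>a\<close> is extended by zero to all other sets.
\<close>

definition represents ::
    "(('a::{field,finite} ^ 'm::finite) set \<Rightarrow> 'k::field) \<Rightarrow> (('a ^ 'm) set \<Rightarrow> 'k) \<Rightarrow> bool" where
  "represents a c \<longleftrightarrow>
     {H. a H \<noteq> 0} \<subseteq> pg_hyperplanes \<and> card {H. a H \<noteq> 0} = m_of c \<and>
     c = (\<Sum>H | a H \<noteq> 0. fun_scale (a H) (char_fun H))"

text \<open>
  For codewords \<open>c\<close> of weight at most \<open>W p h n\<close> it is a known theorem (not proved here) that
  exactly one \<open>a\<close> represents \<open>c\<close>; the next two definitions are meant for such \<open>c\<close>.
\<close>

definition hyps_of :: "(('a::{field,finite} ^ 'm::finite) set \<Rightarrow> 'k::field) \<Rightarrow> ('a ^ 'm) set set" where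
  "hyps_of c = {H. \<exists>a. represents a c \<and> a H \<noteq> 0}"

definition coeff_of ::
    "(('a::{field,finite} ^ 'm::finite) set \<Rightarrow> 'k::field) \<Rightarrow> ('a ^ 'm) set \<Rightarrow> 'k" where
  "coeff_of c H = (THE x. \<exists>a. represents a c \<and> a H = x)"

definition restr ::
    "(('a::{field,finite} ^ 'm::finite) set \<Rightarrow> 'k::field) \<Rightarrow> ('a ^ 'm) set set
      \<Rightarrow> ('a ^ 'm) set \<Rightarrow> 'k" where
  "restr c A = (\<Sum>H\<in>A. fun_scale (coeff_of c H) (char_fun H))"

definition Gamma_edges ::
    "(('a::{field,finite} ^ 'm::finite) set \<Rightarrow> 'k::field) \<Rightarrow> ('a ^ 'm) set set set
      \<Rightarrow> (('a ^ 'm) set set \<times> ('a ^ 'm) set set) set" where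
  "Gamma_edges c HH =
     {(A, B). A \<in> HH \<and> B \<in> HH \<and> A \<noteq> B \<and>
        (\<exists>P \<in> holes c. restr c A P \<noteq> 0 \<and> restr c B P \<noteq> 0 \<and>
           (\<forall>C \<in> HH - {A, B}. restr c C P = 0))}"

text \<open>
  The edge relation is symmetric, so the classes of its reflexive transitive closure on the
  vertex set are the connected components.
\<close>

definition merge_parts ::
    "(('a::{field,finite} ^ 'm::finite) set \<Rightarrow> 'k::field) \<Rightarrow> ('a ^ 'm) set set set
      \<Rightarrow> ('a ^ 'm) set set set" where
  "merge_parts c HH = Union ` (HH // (Gamma_edges c HH)\<^sup>*)"

primrec partition_seq ::
    "(('a::{field,finite} ^ 'm::finite) set \<Rightarrow> 'k::field) \<Rightarrow> nat \<Rightarrow> ('a ^ 'm) set set set" where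
  "partition_seq c 0 = (\<lambda>H. {H}) ` hyps_of c"
| "partition_seq c (Suc i) = merge_parts c (partition_seq c i)"

definition partition_inf ::
    "(('a::{field,finite} ^ 'm::finite) set \<Rightarrow> 'k::field) \<Rightarrow> ('a ^ 'm) set set set" where
  "partition_inf c = (THE HH. \<exists>N. \<forall>i\<ge>N. partition_seq c i = HH)"

definition P_inf ::
    "(('a::{field,finite} ^ 'm::finite) set \<Rightarrow> 'k::field) \<Rightarrow> ('a ^ 'm) set set" where
  "P_inf c = {P \<in> holes c. \<exists>A \<in> partition_inf c. restr c A P \<noteq> 0}"

end

theory Submission
  imports Defs "HOL-Library.Disjoint_Sets"
begin

text \<open>
  Fewer than \<open>q\<close> distinct hyperplanes have linearly independent characteristic functions, since
  no hyperplane is covered by fewer than \<open>q\<close> proper subspaces. Hence a codeword of small weight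
  has at most one representation; if it had none, the limit partition would be empty, against the
  hypothesis. Now look for \<open>c' = \<Sum>\<^sub>A \<beta>\<^sub>A c|\<^sub>A\<close>, the sum running over the parts of the limit
  partition. At holes outside \<open>P_inf c\<close> every summand vanishes, so \<open>supp c' \<subseteq> supp c\<close> amounts to
  one linear condition on \<open>\<beta>\<close> for each point of \<open>P_inf c\<close>. As there are at least two more parts
  than conditions, some solution \<open>\<beta>\<close> is zero on one part and not on all of them, and linear
  independence shows that the corresponding \<open>c'\<close> is not a multiple of \<open>c\<close>.
\<close>

section \<open>Linear algebra\<close>

lemma sum_fun_apply: "(\<Sum>x\<in>A. f x) y = (\<Sum>x\<in>A. f x y)"
  by (induction A rule: infinite_finite_induct) auto

text \<open>Gaussian elimination by induction on the set \<open>Y\<close> of equations: an equation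
  that involves an unknown \<open>x0\<close> is used to remove \<open>x0\<close> from the others, at
  the cost of one unknown and one equation.\<close>

lemma homogeneous_system_nontrivial_solution:
  fixes f :: "'x \<Rightarrow> 'y \<Rightarrow> 'k::field"
  assumes "finite Y" "finite X" "card Y < card X"
  shows "\<exists>\<beta>. (\<exists>x\<in>X. \<beta> x \<noteq> 0) \<and> (\<forall>y\<in>Y. (\<Sum>x\<in>X. \<beta> x * f x y) = 0)"
  using assms
proof (induction Y arbitrary: X f rule: finite_induct)
  case empty
  then have "X \<noteq> {}" by auto
  then show ?case by (intro exI[of _ "\<lambda>_. 1"]) auto
next
  case (insert y Y)
  show ?case
  proof (cases "\<forall>x\<in>X. f x y = 0")
    case True
    from insert.IH[of X f] insert.prems insert.hyps
    obtain \<beta> where "\<exists>x\<in>X. \<beta> x \<noteq> 0" "\<forall>z\<in>Y. (\<Sum>x\<in>X. \<beta> x * f x z) = 0"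
      by auto
    with True show ?thesis by (intro exI[of _ \<beta>]) auto
  next
    case False
    then obtain x0 where x0: "x0 \<in> X" "f x0 y \<noteq> 0" by blast
    define X' where "X' = X - {x0}"
    define r where "r x = f x y / f x0 y" for x
    have X: "X = insert x0 X'" "x0 \<notin> X'" "finite X'"
      using x0 insert.prems by (auto simp: X'_def)
    with insert.prems insert.hyps have "card Y < card X'" by simp
    from insert.IH[OF X(3) this, of "\<lambda>x z. f x z - r x * f x0 z"]
    obtain \<beta> where nz: "\<exists>x\<in>X'. \<beta> x \<noteq> 0"
      and sol: "\<And>z. z \<in> Y \<Longrightarrow> (\<Sum>x\<in>X'. \<beta> x * (f x z - r x * f x0 z)) = 0"
      by auto
    \<comment> \<open>The value at \<open>x0\<close> is forced by equation \<open>y\<close>;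
      inserting it turns every equation into its reduced form, whose coefficients at
      \<open>y\<close> all vanish.\<close>
    define \<gamma> where "\<gamma> = \<beta>(x0 := - (\<Sum>x\<in>X'. \<beta> x * r x))"
    have \<gamma>: "(\<Sum>x\<in>X. \<gamma> x * f x z) = (\<Sum>x\<in>X'. \<beta> x * (f x z - r x * f x0 z))" for z
    proof -
      have "(\<Sum>x\<in>X'. \<gamma> x * f x z) = (\<Sum>x\<in>X'. \<beta> x * f x z)"
        using X(2) by (intro sum.cong) (auto simp: \<gamma>_def)
      then have "(\<Sum>x\<in>X. \<gamma> x * f x z)
          = (\<Sum>x\<in>X'. \<beta> x * f x z) - (\<Sum>x\<in>X'. \<beta> x * r x) * f x0 z"
        using X by (simp add: \<gamma>_def)
      also have "\<dots> = (\<Sum>x\<in>X'. \<beta> x * (f x z - r x * f x0 z))"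
        by (simp add: right_diff_distrib sum_subtractf sum_distrib_right mult.assoc)
      finally show ?thesis .
    qed
    have "(\<Sum>x\<in>X. \<gamma> x * f x y) = 0"
      unfolding \<gamma> using x0 by (simp add: r_def)
    moreover have "\<forall>z\<in>Y. (\<Sum>x\<in>X. \<gamma> x * f x z) = 0"
      unfolding \<gamma> using sol by simp
    moreover have "\<exists>x\<in>X. \<gamma> x \<noteq> 0"
      using nz X by (auto simp: \<gamma>_def)
    ultimately show ?thesis by blast
  qed
qed

text \<open>For \<open>w\<close> in \<open>V\<close> outside \<open>U\<close>, the translates of
  \<open>U\<close> by the scalar multiples of \<open>w\<close> are pairwise disjoint and lie in
  \<open>V\<close>.\<close>

lemma card_proper_subspace_le:
  fixes U V :: "('a::{field,finite} ^ 'm::finite) set"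
  assumes "vec.subspace U" "vec.subspace V" "U \<subset> V"
  shows "CARD('a) * card U \<le> card V"
proof -
  from assms(3) obtain w where w: "w \<in> V" "w \<notin> U" by blast
  define g where "g = (\<lambda>(t::'a, u). t *s w + u)"
  have "inj_on g (UNIV \<times> U)"
  proof (rule inj_onI, clarsimp simp: g_def)
    fix t u t' u'
    assume u: "u \<in> U" "u' \<in> U" and eq: "t *s w + u = t' *s w + u'"
    have d: "(t - t') *s w = u' - u"
      using eq by (simp add: vec.scale_left_diff_distrib algebra_simps)
    have "t = t'"
    proof (rule ccontr)
      assume "t \<noteq> t'"
      then have "w = inverse (t - t') *s ((t - t') *s w)" by simp
      also have "\<dots> \<in> U"
        unfolding d using assms(1) u by (intro vec.subspace_scale vec.subspace_diff)
      finally show False using w by simp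
    qed
    with eq show "t = t' \<and> u = u'" by simp
  qed
  moreover have "g ` (UNIV \<times> U) \<subseteq> V"
    using assms w by (auto simp: g_def intro!: vec.subspace_add vec.subspace_scale)
  ultimately have "card ((UNIV :: 'a set) \<times> U) \<le> card V"
    by (intro card_inj_on_le) auto
  then show ?thesis by (simp add: card_cartesian_product)
qed

text \<open>Counting: with q = \<open>CARD('a)\<close>, each member of \<open>F\<close> has at most
  a fraction 1/q of the vectors of \<open>V\<close>, and there are fewer than q members.\<close>

lemma not_covered_by_few_proper_subspaces:
  fixes V :: "('a::{field,finite} ^ 'm::finite) set"
  assumes "vec.subspace V" "card F < CARD('a)"
    and "\<And>U. U \<in> F \<Longrightarrow> vec.subspace U \<and> U \<subset> V"
  shows "\<exists>v\<in>V. \<forall>U\<in>F. v \<notin> U"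
proof (rule ccontr)
  assume "\<not> ?thesis"
  then have "V \<subseteq> \<Union>F" by blast
  then have "card V \<le> card (\<Union>F)" by (intro card_mono) auto
  also have "\<dots> \<le> (\<Sum>U\<in>F. card U)"
    by (rule card_Union_le_sum_card)
  finally have "CARD('a) * card V \<le> (\<Sum>U\<in>F. CARD('a) * card U)"
    by (simp flip: sum_distrib_left)
  also have "\<dots> \<le> (\<Sum>U\<in>F. card V)"
    using assms by (intro sum_mono card_proper_subspace_le) auto
  also have "\<dots> = card F * card V" by simp
  \<comment> \<open>Strict because \<open>V\<close> contains 0 and so has positive
    cardinality.\<close>
  also have "\<dots> < CARD('a) * card V"
    using assms vec.subspace_0[of V] by (auto simp: card_gt_0_iff)
  finally show False by simp
qed

text \<open>Some point of \<open>H\<close> lies on no other member of \<open>S\<close>; evaluating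
  the relation there leaves only the term of \<open>H\<close>.\<close>

lemma hyperplanes_independent:
  fixes S :: "('a::{field,finite} ^ 'm::finite) set set"
    and b :: "('a ^ 'm) set \<Rightarrow> 'k::field"
  assumes S: "S \<subseteq> pg_hyperplanes" "card S < CARD('a)" and m: "CARD('m) \<ge> 2"
    and zero: "\<And>P. P \<in> pg_points \<Longrightarrow> (\<Sum>H\<in>S. b H * char_fun H P) = 0"
    and H: "H \<in> S"
  shows "b H = 0"
proof -
  have sub: "vec.subspace K" "vec.dim K + 1 = CARD('m)" if "K \<in> S" for K
    using S that by (auto simp: pg_hyperplanes_def)
  \<comment> \<open>The subspace \<open>{0}\<close> takes the place of \<open>H\<close>: it makes
    \<open>v\<close> nonzero, so that \<open>v\<close> spans a point, and \<open>F\<close> is still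
    no larger than \<open>S\<close>.\<close>
  define F where "F = insert {0} ((\<lambda>K. K \<inter> H) ` (S - {H}))"
  have "card F \<le> Suc (card ((\<lambda>K. K \<inter> H) ` (S - {H})))"
    unfolding F_def by (simp add: card_insert_if)
  also have "\<dots> \<le> Suc (card (S - {H}))" by (simp add: card_image_le)
  also have "\<dots> = card S" using H by (simp only: card_Suc_Diff1 finite)
  finally have cF: "card F < CARD('a)" using S by simp
  have "vec.subspace U \<and> U \<subset> H" if U: "U \<in> F" for U
  proof (cases "U = {0}")
    case True
    then show ?thesis using sub[OF H] m by (auto simp: vec.subspace_0)
  next
    case False
    then obtain K where K: "K \<in> S" "K \<noteq> H" "U = K \<inter> H" using U by (auto simp: F_def)
    have "\<not> H \<subseteq> K"
    proof
      assume "H \<subseteq> K"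
      moreover have "vec.dim K \<le> vec.dim H" using sub[OF H] sub[OF K(1)] by simp
      ultimately have "H = K"
        using sub(1)[OF H] sub(1)[OF K(1)] by (intro vec.subspace_dim_equal)
      with K show False by simp
    qed
    with K sub show ?thesis using H by (auto intro: vec.subspace_inter)
  qed
  from not_covered_by_few_proper_subspaces[OF sub(1)[OF H] cF this]
  obtain v where v: "v \<in> H" "\<forall>U\<in>F. v \<notin> U" by blast
  then have v0: "v \<noteq> 0" by (auto simp: F_def)
  define P where "P = vec.span {v}"
  have P: "P \<in> pg_points"
    using v0 by (simp add: P_def pg_points_def)
  have iff: "P \<subseteq> K \<longleftrightarrow> K = H" if "K \<in> S" for K
  proof -
    have "P \<subseteq> K \<longleftrightarrow> v \<in> K"
      using vec.span_minimal[OF _ sub(1)[OF that], of "{v}"] vec.span_base[of v "{v}"]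
      by (auto simp: P_def)
    moreover have "v \<in> K \<longleftrightarrow> K = H"
      using v that by (auto simp: F_def)
    ultimately show ?thesis by simp
  qed
  have "0 = (\<Sum>K\<in>S. b K * char_fun K P)" using zero[OF P] by simp
  also have "\<dots> = (\<Sum>K\<in>S. if K = H then b H else 0)"
    using iff P by (intro sum.cong) (auto simp: char_fun_def)
  also have "\<dots> = b H" using H by simp
  finally show ?thesis by simp
qed

section \<open>Uniqueness of the representation\<close>

lemma represents_apply:
  assumes "represents a c"
  shows "c P = (\<Sum>H | a H \<noteq> 0. a H * char_fun H P)"
proof -
  have "c = (\<Sum>H | a H \<noteq> 0. fun_scale (a H) (char_fun H))"
    using assms unfolding represents_def by blast
  from fun_cong[OF this, of P] show ?thesis
    unfolding sum_fun_apply fun_scale_def .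
qed

text \<open>The difference of two representations is a vanishing combination of at most
  \<open>2 * m_of c\<close> hyperplanes, few enough for independence.\<close>

lemma represents_unique:
  fixes c :: "('a::{field,finite} ^ 'm::finite) set \<Rightarrow> 'k::field"
  assumes a: "represents a c" and b: "represents b c"
    and small: "2 * m_of c < CARD('a)" and m: "CARD('m) \<ge> 2"
  shows "a = b"
proof -
  define S where "S = {H. a H \<noteq> 0} \<union> {H. b H \<noteq> 0}"
  have S: "S \<subseteq> pg_hyperplanes" using a b by (auto simp: S_def represents_def)
  have "card S \<le> 2 * m_of c"
    using a b card_Un_le[of "{H. a H \<noteq> 0}" "{H. b H \<noteq> 0}"]
    by (simp add: S_def represents_def)
  with small have cS: "card S < CARD('a)" by simp
  have ev: "c P = (\<Sum>H\<in>S. d H * char_fun H P)"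
    if "represents d c" "{H. d H \<noteq> 0} \<subseteq> S" for d P
  proof -
    have "c P = (\<Sum>H | d H \<noteq> 0. d H * char_fun H P)"
      using that(1) by (rule represents_apply)
    also have "\<dots> = (\<Sum>H\<in>S. d H * char_fun H P)"
      using that(2) by (intro sum.mono_neutral_left) auto
    finally show ?thesis .
  qed
  have "a H - b H = 0" if "H \<in> S" for H
  proof (rule hyperplanes_independent[OF S cS m _ that, of "\<lambda>H. a H - b H"])
    show "(\<Sum>H\<in>S. (a H - b H) * char_fun H P) = 0" for P
      using ev[OF a, of P] ev[OF b, of P]
      by (simp add: S_def left_diff_distrib sum_subtractf)
  qed
  then have "a H = b H" for H
    by (cases "H \<in> S") (auto simp: S_def)
  then show ?thesis by (rule ext)
qed

text \<open>Here \<open>m_of c\<close> is at most \<open>Delta p h n\<close>, which is at most the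
  square root of q, and 2 sqrt(q) < q as soon as q > 4.\<close>

lemma m_of_small:
  fixes c :: "('a::{field,finite} ^ 'm::finite) set \<Rightarrow> 'k::field"
  assumes "h \<ge> 2" "CARD('a) = p ^ h" "CARD('a) > 4" "CARD('m) = n + 1"
    and "real (wt c) \<le> W p h n"
  shows "2 * m_of c < CARD('a)"
proof -
  define q where "q = CARD('a)"
  define t where "t = theta q (n - 1)"
  have "q > 4" using assms(3) by (simp only: q_def)
  then have q: "real q > 4" by simp
  have qp: "q = p ^ h" using assms(2) by (simp only: q_def)
  have "1 < real q ^ (n - 1 + 1)" using q by (intro one_less_power) auto
  then have t: "t > 0"
    unfolding t_def theta_def using q by (intro divide_pos_pos) linarith+
  have "real (wt c) \<le> of_int (Delta p h n - 1) * t"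
    using assms(5) by (simp add: W_def t_def flip: qp)
  then have "real (wt c) / t \<le> of_int (Delta p h n - 1)"
    using t by (simp add: field_simps)
  then have "\<lceil>real (wt c) / t\<rceil> \<le> Delta p h n - 1" by (rule ceiling_le)
  moreover have "m_of c = nat \<lceil>real (wt c) / t\<rceil>"
    using assms by (simp add: m_of_def t_def q_def)
  \<comment> \<open>A nonnegative ceiling makes the truncation by \<open>nat\<close>
    harmless.\<close>
  moreover have "0 \<le> \<lceil>real (wt c) / t\<rceil>"
    using t less_le_trans[of "-1::real" 0 "real (wt c) / t"] by (simp add: zero_le_ceiling)
  ultimately have m: "real (m_of c) \<le> of_int (Delta p h n)" by linarith
  have le: "x / 2 ^ k \<le> x" if "x \<ge> 0" for x :: real and k :: nat
    using that mult_left_mono[of 1 "2 ^ k" x] by (simp add: field_simps)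
  have "of_int (Delta p h n) \<le> sqrt (real q)"
  proof (cases "h > 2")
    case True
    then show ?thesis
      using order_trans[OF of_int_floor_le le[of "sqrt (real q)" "n - 2"]]
      by (simp add: Delta_def flip: qp)
  next
    case False
    then have "h = 2" using assms by simp
    \<comment> \<open>For \<open>h = 2\<close> the square root of q is \<open>p\<close>
      itself.\<close>
    then show ?thesis
      using qp order_trans[OF of_int_floor_le le[of "real p" n]]
      by (simp add: Delta_def)
  qed
  with m have "real (m_of c) \<le> sqrt (real q)" by linarith
  moreover have "2 * sqrt (real q) < sqrt (real q) * sqrt (real q)"
    using q real_less_rsqrt[of 2 "real q"] by (intro mult_strict_right_mono) auto
  ultimately have "2 * real (m_of c) < real q" by simp
  then show ?thesis by (simp add: q_def)
qed

section \<open>The limit partition\<close>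

text \<open>The closure is reflexive on the whole type, hence \<open>UNIV\<close>; anything outside
  \<open>HH\<close> forms a class of its own.\<close>

lemma Gamma_edges_rtrancl_equiv: "equiv UNIV ((Gamma_edges c HH)\<^sup>*)"
proof -
  have "sym (Gamma_edges c HH)"
    by (rule symI) (auto simp: Gamma_edges_def insert_commute)
  then show ?thesis
    by (intro equivI) (auto intro: refl_rtrancl sym_rtrancl trans_rtrancl)
qed

lemma Gamma_edges_class_subset:
  assumes "A \<in> HH"
  shows "(Gamma_edges c HH)\<^sup>* `` {A} \<subseteq> HH"
proof -
  have "B \<in> HH" if "(A, B) \<in> (Gamma_edges c HH)\<^sup>*" for B
    using that assms by (induction rule: rtrancl_induct) (auto simp: Gamma_edges_def)
  then show ?thesis by auto
qed

lemma merge_parts_eq: "merge_parts c HH = (\<lambda>A. \<Union>((Gamma_edges c HH)\<^sup>* `` {A})) ` HH"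
  unfolding merge_parts_def quotient_def by blast

lemma partition_on_merge_parts:
  assumes "partition_on X HH"
  shows "partition_on X (merge_parts c HH)"
proof -
  let ?R = "(Gamma_edges c HH)\<^sup>*"
  have cls: "A \<in> ?R `` {A}" for A by auto
  show ?thesis
  proof (rule partition_onI)
    show "\<Union>(merge_parts c HH) = X"
    proof
      show "\<Union>(merge_parts c HH) \<subseteq> X"
        unfolding merge_parts_eq partition_onD1[OF assms]
        using Gamma_edges_class_subset[of _ HH c] by blast
      show "X \<subseteq> \<Union>(merge_parts c HH)"
        unfolding merge_parts_eq partition_onD1[OF assms] using cls by blast
    qed
    show "disjnt U V" if UV: "U \<in> merge_parts c HH" "V \<in> merge_parts c HH" "U \<noteq> V" for U V
    proof (rule ccontr)
      assume "\<not> disjnt U V"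
      then obtain x where x: "x \<in> U" "x \<in> V" by (auto simp: disjnt_def)
      from UV obtain A B where AB: "A \<in> HH" "B \<in> HH" "U = \<Union>(?R `` {A})" "V = \<Union>(?R `` {B})"
        unfolding merge_parts_eq by blast
      from x AB obtain C D where CD: "(A, C) \<in> ?R" "x \<in> C" "(B, D) \<in> ?R" "x \<in> D"
        by blast
      then have "C \<in> HH" "D \<in> HH"
        using Gamma_edges_class_subset[OF AB(1)] Gamma_edges_class_subset[OF AB(2)] by blast+
      \<comment> \<open>The old parts are disjoint, so a common point of two unions lies in a single
        old part, which links the two components.\<close>
      then have "C = D"
        using partition_onD2[OF assms] CD by (auto simp: disjoint_def)
      then have "?R `` {A} = ?R `` {B}"
        using CD equiv_class_eq[OF Gamma_edges_rtrancl_equiv[of c HH]] by blast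
      with AB UV show False by simp
    qed
    show "{} \<notin> merge_parts c HH"
    proof
      assume "{} \<in> merge_parts c HH"
      then obtain A where "A \<in> HH" "{} = \<Union>(?R `` {A})"
        unfolding merge_parts_eq by blast
      moreover from this have "A = {}" using cls[of A] by blast
      ultimately have "{} \<in> HH" by blast
      then show False using partition_onD3[OF assms] by simp
    qed
  qed
qed

lemma partition_on_partition_seq: "partition_on (hyps_of c) (partition_seq c i)"
proof (induction i)
  case 0
  show ?case by (rule partition_onI) auto
next
  case (Suc i)
  then show ?case by (simp add: partition_on_merge_parts)
qed

lemma merge_parts_no_edges:
  assumes "Gamma_edges c HH = {}"
  shows "merge_parts c HH = HH"
  unfolding merge_parts_eq assms by simp

lemma card_merge_parts_less:
  assumes "Gamma_edges c HH \<noteq> {}"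
  shows "card (merge_parts c HH) < card HH"
proof -
  let ?R = "(Gamma_edges c HH)\<^sup>*"
  from assms obtain A B where AB: "(A, B) \<in> Gamma_edges c HH" by auto
  then have HH: "A \<in> HH" "B \<in> HH" "A \<noteq> B" by (auto simp: Gamma_edges_def)
  have eq: "?R `` {A} = ?R `` {B}"
    using AB equiv_class_eq[OF Gamma_edges_rtrancl_equiv[of c HH]] by blast
  have "(\<lambda>A. \<Union>(?R `` {A})) ` insert A (HH - {A}) = (\<lambda>A. \<Union>(?R `` {A})) ` (HH - {A})"
    using HH eq unfolding image_insert by blast
  then have "merge_parts c HH = (\<lambda>A. \<Union>(?R `` {A})) ` (HH - {A})"
    using HH by (simp only: merge_parts_eq insert_Diff)
  then have "card (merge_parts c HH) \<le> card (HH - {A})"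
    by (simp add: card_image_le)
  also have "\<dots> < card HH" using HH by (intro card_Diff1_less) auto
  finally show ?thesis .
qed

lemma partition_inf_eq_partition_seq: "\<exists>N. partition_inf c = partition_seq c N"
proof -
  \<comment> \<open>At an index of least cardinality no edge is left, since a further merge would
    lower the count; from there on the sequence is constant.\<close>
  obtain N where N: "\<And>i. card (partition_seq c N) \<le> card (partition_seq c i)"
    using ex_has_least_nat[of "\<lambda>_. True" _ "\<lambda>i. card (partition_seq c i)"] by blast
  have "Gamma_edges c (partition_seq c N) = {}"
    using card_merge_parts_less[of c "partition_seq c N"] N[of "Suc N"] by fastforce
  then have fixp: "merge_parts c (partition_seq c N) = partition_seq c N"
    by (rule merge_parts_no_edges)
  have const: "partition_seq c i = partition_seq c N" if "i \<ge> N" for i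
    using that by (induction i rule: dec_induct) (simp_all add: fixp)
  have "partition_inf c = partition_seq c N"
    unfolding partition_inf_def
  proof (rule the_equality)
    show "\<exists>M. \<forall>i\<ge>M. partition_seq c i = partition_seq c N" using const by blast
    \<comment> \<open>Two eventual values agree at a common late index.\<close>
    show "HH = partition_seq c N" if ex: "\<exists>M. \<forall>i\<ge>M. partition_seq c i = HH" for HH
    proof -
      from ex obtain M where "\<forall>i\<ge>M. partition_seq c i = HH" by blast
      then have "partition_seq c (max M N) = HH" by simp
      then show ?thesis using const[of "max M N"] by simp
    qed
  qed
  then show ?thesis by blast
qed

lemma partition_on_partition_inf: "partition_on (hyps_of c) (partition_inf c)"
  using partition_inf_eq_partition_seq[of c] partition_on_partition_seq[of c] by auto

section \<open>The theorem\<close>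

text \<open>The weight bound enters only as \<open>2 * m_of c < CARD('a)\<close>, which makes the
  representation unique and the hyperplanes of \<open>c\<close> independent.\<close>

lemma not_minimal_if_few_P_inf:
  fixes c :: "('a::{field,finite} ^ 'm::finite) set \<Rightarrow> 'k::field"
  assumes small: "2 * m_of c < CARD('a)" and m: "CARD('m) \<ge> 2"
    and few: "card (P_inf c) + 2 \<le> card (partition_inf c)"
  shows "\<not> minimal_codeword c"
proof
  assume min: "minimal_codeword c"
  let ?T = "partition_inf c"
  have part: "partition_on (hyps_of c) ?T" by (rule partition_on_partition_inf)
  have "?T \<noteq> {}" using few by auto
  \<comment> \<open>Parts are nonempty, so a nonempty partition yields a hyperplane and with it a
    representation of \<open>c\<close>.\<close>
  then have "hyps_of c \<noteq> {}" using partition_onD1[OF part] partition_onD3[OF part] by auto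
  then obtain a where a: "represents a c" by (auto simp: hyps_of_def)
  have uniq: "represents b c \<longleftrightarrow> b = a" for b
    using represents_unique[OF _ a small m, of b] a by blast
  have hyps: "hyps_of c = {H. a H \<noteq> 0}"
    by (simp add: hyps_of_def uniq)
  have coeff: "coeff_of c H = a H" for H
    by (simp add: coeff_of_def uniq)
  have hyp: "hyps_of c \<subseteq> pg_hyperplanes" and card: "card (hyps_of c) = m_of c"
    using a unfolding hyps represents_def by blast+
  have c: "c P = (\<Sum>H\<in>hyps_of c. a H * char_fun H P)" for P
    unfolding hyps using a by (rule represents_apply)
  have restr: "restr c A P = (\<Sum>H\<in>A. a H * char_fun H P)" for A P
    by (simp add: restr_def sum_fun_apply fun_scale_def coeff)
  have sum_parts: "(\<Sum>H\<in>hyps_of c. g H) = (\<Sum>A\<in>?T. \<Sum>H\<in>A. g H)" for g :: "_ \<Rightarrow> 'k"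
  proof -
    have "\<forall>A\<in>?T. \<forall>B\<in>?T. A \<noteq> B \<longrightarrow> A \<inter> B = {}"
      using partition_onD2[OF part] by (auto simp: disjoint_def)
    from sum.Union_disjoint[OF _ this, of g] show ?thesis
      unfolding partition_onD1[OF part] by simp
  qed
  \<comment> \<open>Reserving one part for the value 0 still leaves more unknowns than points of
    \<open>P_inf c\<close>.\<close>
  obtain A0 where A0: "A0 \<in> ?T" using \<open>?T \<noteq> {}\<close> by blast
  have "card (P_inf c) < card (?T - {A0})" using few A0 by simp
  from homogeneous_system_nontrivial_solution[OF _ _ this, of "restr c"]
  obtain \<beta>0 where nz: "\<exists>A\<in>?T - {A0}. \<beta>0 A \<noteq> 0"
    and sol: "\<And>P. P \<in> P_inf c \<Longrightarrow> (\<Sum>A\<in>?T - {A0}. \<beta>0 A * restr c A P) = 0"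
    by auto
  define \<beta> where "\<beta> = \<beta>0(A0 := 0)"
  define c' where "c' = (\<Sum>A\<in>?T. fun_scale (\<beta> A) (restr c A))"
  have c': "c' P = (\<Sum>A\<in>?T. \<beta> A * restr c A P)" for P
    by (simp add: c'_def sum_fun_apply fun_scale_def)
  have "A \<subseteq> hyps_of c" if "A \<in> ?T" for A using that partition_onD1[OF part] by blast
  then have "c' \<in> hyp_code"
    unfolding c'_def hyp_code_def restr_def using hyp
    by (intro funsp.span_sum funsp.span_scale funsp.span_base) blast
  moreover have "supp c' \<subseteq> supp c"
  proof
    fix P assume P: "P \<in> supp c'"
    show "P \<in> supp c"
    proof (rule ccontr)
      assume "P \<notin> supp c"
      with P have hole: "P \<in> holes c" by (auto simp: holes_def supp_def)
      \<comment> \<open>On \<open>P_inf c\<close> the linear system applies; at any other hole each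
        \<open>restr c A\<close> is already zero.\<close>
      have "c' P = 0"
      proof (cases "P \<in> P_inf c")
        case True
        have "c' P = (\<Sum>A\<in>?T - {A0}. \<beta>0 A * restr c A P)"
          unfolding c' using A0 by (simp add: sum.remove[OF _ A0] \<beta>_def)
        with sol[OF True] show ?thesis by simp
      next
        case False
        with hole show ?thesis by (auto simp: c' P_inf_def intro!: sum.neutral)
      qed
      with P show False by (simp add: supp_def)
    qed
  qed
  ultimately obtain \<alpha> where \<alpha>: "c' = fun_scale \<alpha> c"
    using min by (auto simp: minimal_codeword_def)
  \<comment> \<open>The part containing \<open>H\<close>: it turns one scalar per part into one
    coefficient per hyperplane.\<close>
  define pt where "pt H = (THE A. A \<in> ?T \<and> H \<in> A)" for H
  have pt: "pt H = A" if "A \<in> ?T" "H \<in> A" for A H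
    unfolding pt_def using that partition_onD2[OF part]
    by (intro the_equality) (auto simp: disjoint_def)
  \<comment> \<open>The sum is c' - \<alpha> c expanded in the hyperplanes of \<open>c\<close>, so
    independence will make its coefficients vanish.\<close>
  have "(\<Sum>H\<in>hyps_of c. (\<beta> (pt H) - \<alpha>) * a H * char_fun H P) = 0" for P
  proof -
    have "(\<Sum>H\<in>hyps_of c. \<beta> (pt H) * (a H * char_fun H P)) = c' P"
      unfolding sum_parts c' restr sum_distrib_left by (intro sum.cong) (auto simp: pt)
    moreover have "(\<Sum>H\<in>hyps_of c. \<alpha> * (a H * char_fun H P)) = c' P"
      unfolding \<alpha> by (simp add: fun_scale_def c sum_distrib_left)
    ultimately show ?thesis
      by (simp add: left_diff_distrib sum_subtractf mult.assoc)
  qed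
  moreover have "card (hyps_of c) < CARD('a)" using small card by simp
  ultimately have "(\<beta> (pt H) - \<alpha>) * a H = 0" if "H \<in> hyps_of c" for H
    using hyperplanes_independent[OF hyp _ m, of "\<lambda>H. (\<beta> (pt H) - \<alpha>) * a H"] that by blast
  then have pt_\<alpha>: "\<beta> (pt H) = \<alpha>" if "H \<in> hyps_of c" for H
    using that hyps by auto
  \<comment> \<open>Every part contains a hyperplane, so \<beta> is constant on the parts; this
    clashes with its value 0 at \<open>A0\<close> and a nonzero value elsewhere.\<close>
  have \<beta>_const: "\<beta> A = \<alpha>" if A: "A \<in> ?T" for A
  proof -
    from A obtain H where "H \<in> A" using partition_onD3[OF part] by fastforce
    with A show ?thesis using pt_\<alpha>[of H] pt[of A H] partition_onD1[OF part] by auto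
  qed
  from nz obtain A where "A \<in> ?T" "A \<noteq> A0" "\<beta>0 A \<noteq> 0" by blast
  with \<beta>_const[of A] \<beta>_const[OF A0] show False by (simp add: \<beta>_def)
qed

theorem theorem3p9:
  fixes p h q n :: nat
    and c :: "('a::{field,finite} ^ 'm::finite) set \<Rightarrow> 'k::{field,finite}"
  assumes "prime p" and "h \<ge> 2" and "q = p ^ h" and "q > 27" and "n \<ge> 2"
    and "h > 2 \<Longrightarrow> q \<ge> max 32 (2 ^ (2 * n - 4))"
    and "h = 2 \<Longrightarrow> q \<ge> 2 ^ (2 * n)"
    and "CARD('k) = p" and "CARD('a) = q" and "CARD('m) = n + 1"
    and "c \<in> hyp_code"
    and "real (wt c) \<le> W p h n"
    and "int (card (P_inf c)) \<le> int (card (partition_inf c)) - 2"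
  shows "\<not> minimal_codeword c"
proof (rule not_minimal_if_few_P_inf)
  show "2 * m_of c < CARD('a)"
    using assms by (intro m_of_small[of h p n]) auto
  show "CARD('m) \<ge> 2" using assms by simp
  show "card (P_inf c) + 2 \<le> card (partition_inf c)" using assms by linarith
qed

end
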